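(* Let $\Phi$ be a point process on $\mathbb R^d$ with Papangelou intensity $c$ (with respect to Lebesgue measure), let $\epsilon>0$ and let $\Phi^{(\epsilon)}$ be the $\epsilon$-rescaling of $\Phi$. Then the Papangelou intensity $c^{(\epsilon)}$ of $\Phi^{(\epsilon)}$ is given, for any $x\in\mathbb R^d$ and any finite configuration $\phi\in\widehat N_{\mathbb R^d}$, by $$c^{(\epsilon)}(x,\phi)=\frac1\epsilon\,c\big(\epsilon^{-1/d}x,\epsilon^{-1/d}\phi\big).$$
   Context: $N_{\mathbb R^d}$ is the set of configurations, i.e. nonnegative-integer-valued measures on $\mathbb R^d$ finite on bounded Borel sets, with the smallest $\sigma$-algebra making $\phi\mapsto\phi(A)$ measurable for every bounded Borel $A$; $\widehat N_{\mathbb R^d}$ is the set of finite configurations. Configurations are treated as (multi)sets of points: $\sum_{x\in\phi}f(x)=\int f\,\mathrm d\phi$, $\phi\setminus x=\phi-\delta_x$, and $a\phi=\{ax:x\in\phi\}$ for $a>0$. A point process is a random element of $N_{\mathbb R^d}$. The $\epsilon$-rescaling of $\Phi$ is $\Phi^{(\epsilon)}=\epsilon^{1/d}\Phi$. A (version of the) Papangelou intensity of a point process $\Psi$ is a measurable $c:\mathbb R^d\times N_{\mathbb R^d}\to\mathbb R_+$ such that for all measurable $u\ge0$ on $\mathbb R^d\times N_{\mathbb R^d}$, $\mathbb E[\sum_{x\in\Psi}u(x,\Psi\setminus x)]=\int_{\mathbb R^d}\mathbb E[c(x,\Psi)u(x,\Psi)]\,\mathrm dx$. Versions are unique only up to null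 sets of $\mathrm dx\otimes\mathbb P_\Psi$; "is given by" means that there is a version with the stated values. *)

theory Defs
  imports "HOL-Probability.Probability"
begin

(* A configuration is a locally finite counting measure on the Borel sets; it may have
   multiple points and infinite total mass. *)
definition configurations :: "'a::euclidean_space measure set" where
  "configurations =
    {\<phi>. sets \<phi> = sets borel
       \<and> (\<forall>A\<in>sets borel. emeasure \<phi> A \<in> \<nat> \<union> {\<infinity>})
       \<and> (\<forall>A\<in>sets borel. bounded A \<longrightarrow> emeasure \<phi> A < \<infinity>)}"

definition finite_configurations :: "'a::euclidean_space measure set" where
  "finite_configurations = {\<phi> \<in> configurations. emeasure \<phi> UNIV < \<infinity>}"

(* As for subprob_algebra, the supremum of the pullbacks is the smallest sigma-algebra making
   every evaluation at a bounded Borel set measurable; the measure it carries is irrelevant. *)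
definition configuration_space :: "'a::euclidean_space measure measure" where
  "configuration_space =
    (SUP A \<in> {A \<in> sets borel. bounded A}.
       vimage_algebra configurations (\<lambda>\<phi>. emeasure \<phi> A) borel)"

(* The multiset of points a * x for x in \<phi>. *)
definition scale_configuration :: "real \<Rightarrow> 'a::euclidean_space measure \<Rightarrow> 'a measure" where
  "scale_configuration a \<phi> = distr \<phi> borel (\<lambda>x. a *\<^sub>R x)"

(* \<phi> - \<delta>_x, where return borel x is the Dirac measure at x.  This is only meaningful if x is
   a point of \<phi>, which is the case for \<phi>-almost every x. *)
definition remove_point :: "'a::euclidean_space measure \<Rightarrow> 'a \<Rightarrow> 'a measure" where
  "remove_point \<phi> x = diff_measure \<phi> (return borel x)"

definition point_process :: "'w measure \<Rightarrow> ('w \<Rightarrow> 'a::euclidean_space measure) \<Rightarrow> bool" where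
  "point_process M \<Psi> \<longleftrightarrow> prob_space M \<and> \<Psi> \<in> M \<rightarrow>\<^sub>M configuration_space"

definition rescaling ::
    "real \<Rightarrow> ('w \<Rightarrow> 'a::euclidean_space measure) \<Rightarrow> 'w \<Rightarrow> 'a measure" where
  "rescaling \<epsilon> \<Phi> = (\<lambda>\<omega>. scale_configuration (\<epsilon> powr (1 / real DIM('a))) (\<Phi> \<omega>))"

(* c is a version of the Papangelou intensity of the point process \<Psi>.  The integral with respect
   to the counting measure \<Psi> \<omega> is the sum over its points, with multiplicity. *)
definition papangelou_intensity ::
    "'w measure \<Rightarrow> ('w \<Rightarrow> 'a::euclidean_space measure) \<Rightarrow> ('a \<Rightarrow> 'a measure \<Rightarrow> real) \<Rightarrow> bool" where
  "papangelou_intensity M \<Psi> c \<longleftrightarrow>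
     point_process M \<Psi>
   \<and> case_prod c \<in> borel_measurable (borel \<Otimes>\<^sub>M configuration_space)
   \<and> (\<forall>x. \<forall>\<phi>\<in>configurations. 0 \<le> c x \<phi>)
   \<and> (\<forall>u :: 'a \<times> 'a measure \<Rightarrow> ennreal.
        u \<in> borel_measurable (borel \<Otimes>\<^sub>M configuration_space) \<longrightarrow>
        (\<integral>\<^sup>+\<omega>. (\<integral>\<^sup>+x. u (x, remove_point (\<Psi> \<omega>) x) \<partial>\<Psi> \<omega>) \<partial>M)
          = (\<integral>\<^sup>+x. (\<integral>\<^sup>+\<omega>. ennreal (c x (\<Psi> \<omega>)) * u (x, \<Psi> \<omega>) \<partial>M) \<partial>lborel))"

end

theory Submission
  imports Defs
begin

text \<open>Scaling by \<open>a\<close> is a measurable bijection of the configuration space that commutes with removing a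
  point, so the defining identity of the Papangelou intensity for \<open>a \<Phi>\<close> and \<open>u\<close> is the one for \<open>\<Phi>\<close>
  and \<open>(x, \<phi>) \<mapsto> u (a x, a \<phi>)\<close>, up to a linear substitution in the Lebesgue integral. Its
  Jacobian \<open>a\<^sup>-\<^sup>d\<close> is the factor \<open>1 / \<epsilon>\<close>.\<close>

section \<open>Image measures under Borel isomorphisms\<close>

text \<open>The next two lemmas do not assume that \<open>f\<close> is measurable. This matters because the sum over
  the points of a configuration is applied to \<open>x \<mapsto> u (x, \<phi> - \<delta>\<^sub>x)\<close>, whose measurability in \<open>x\<close> is
  not obvious.\<close>

lemma nn_integral_distr_le:
  assumes T: "T \<in> M \<rightarrow>\<^sub>M N"
  shows "(\<integral>\<^sup>+y. f y \<partial>distr M N T) \<le> (\<integral>\<^sup>+x. f (T x) \<partial>M)"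
  \<comment> \<open>The integral is a supremum over simple \<open>g\<close> below \<open>f\<close>.
    Such \<open>g\<close> are measurable even if \<open>f\<close> is not, so the usual transfer
    applies to them. Simple functions below \<open>f \<circ> T\<close> need not factor through
    \<open>T\<close>, so only one inequality results.\<close>
  unfolding nn_integral_def[of "distr M N T"]
proof (rule SUP_least, clarify)
  fix g assume g: "simple_function (distr M N T) g" and le: "g \<le> f"
  have "integral\<^sup>S (distr M N T) g = (\<integral>\<^sup>+y. g y \<partial>distr M N T)"
    using g by (simp add: nn_integral_eq_simple_integral)
  also have "\<dots> = (\<integral>\<^sup>+x. g (T x) \<partial>M)"
    using borel_measurable_simple_function[OF g] by (intro nn_integral_distr[OF T]) simp
  also have "\<dots> \<le> (\<integral>\<^sup>+x. f (T x) \<partial>M)"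
    using le by (intro nn_integral_mono) (simp add: le_fun_def)
  finally show "integral\<^sup>S (distr M N T) g \<le> (\<integral>\<^sup>+x. f (T x) \<partial>M)" .
qed

lemma nn_integral_distr_isomorphism:
  assumes T: "T \<in> M \<rightarrow>\<^sub>M N" and T': "T' \<in> N \<rightarrow>\<^sub>M M"
    and inv: "\<And>x. x \<in> space M \<Longrightarrow> T' (T x) = x" "\<And>y. y \<in> space N \<Longrightarrow> T (T' y) = y"
  shows "(\<integral>\<^sup>+y. f y \<partial>distr M N T) = (\<integral>\<^sup>+x. f (T x) \<partial>M)"
proof (rule antisym[OF nn_integral_distr_le[OF T]])
  \<comment> \<open>Pushing forward along \<open>T'\<close> recovers \<open>M\<close>, so the same
    inequality for \<open>T'\<close> gives the converse bound.\<close>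
  have "distr (distr M N T) M T' = distr M M (T' \<circ> T)"
    using T T' by (rule distr_distr[rotated])
  also have "\<dots> = distr M M (\<lambda>x. x)"
    by (rule distr_cong) (simp_all add: inv)
  finally have "(\<integral>\<^sup>+x. f (T x) \<partial>M) = (\<integral>\<^sup>+x. f (T x) \<partial>distr (distr M N T) M T')"
    by (simp add: distr_id)
  also have "\<dots> \<le> (\<integral>\<^sup>+y. f (T (T' y)) \<partial>distr M N T)"
    using T' by (intro nn_integral_distr_le) simp
  also have "\<dots> = (\<integral>\<^sup>+y. f y \<partial>distr M N T)"
    by (intro nn_integral_cong) (simp add: inv)
  finally show "(\<integral>\<^sup>+x. f (T x) \<partial>M) \<le> (\<integral>\<^sup>+y. f y \<partial>distr M N T)" .
qed

lemma sigma_sets_borel [simp]: "sigma_sets UNIV (sets borel) = sets borel"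
  using sets.sigma_sets_eq[of borel] by simp

lemma measure_space_vimage:
  fixes \<mu> :: "'a::topological_space set \<Rightarrow> ennreal" and T :: "'a \<Rightarrow> 'b::topological_space"
  assumes T: "T \<in> borel \<rightarrow>\<^sub>M borel" and \<mu>: "measure_space UNIV (sets borel) \<mu>"
  shows "measure_space UNIV (sets borel) (\<lambda>A. \<mu> (T -` A))"
proof -
  have pre: "T -` A \<in> sets borel" if "A \<in> sets borel" for A
    using measurable_sets[OF T that] by simp
  have ca: "countably_additive (sets borel) \<mu>" and "positive (sets borel) \<mu>"
    using \<mu> by (auto simp: measure_space_def)
  moreover have "countably_additive (sets borel) (\<lambda>A. \<mu> (T -` A))"
  proof (rule countably_additiveI)
    fix A :: "nat \<Rightarrow> 'b set"
    assume A: "range A \<subseteq> sets borel" "disjoint_family A"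
    show "(\<Sum>i. \<mu> (T -` A i)) = \<mu> (T -` (\<Union>i. A i))"
      unfolding vimage_UN
    proof (rule ca[unfolded countably_additive_def, rule_format])
      show "range (\<lambda>i. T -` A i) \<subseteq> sets borel"
        using A(1) by (auto intro!: pre)
      show "disjoint_family (\<lambda>i. T -` A i)"
        using A(2) by (fastforce simp: disjoint_family_on_def)
      show "(\<Union>i. T -` A i) \<in> sets borel"
        using A(1) by (intro sets.countable_UN) (auto intro!: pre)
    qed
  qed
  ultimately show ?thesis
    using \<mu> by (auto simp: measure_space_def positive_def sets.sigma_algebra_axioms[of borel, simplified])
qed

text \<open>Here \<open>\<mu>\<close> need not be a measure: if it is not, then neither is its image, and both sides
  are the null measure.\<close>

lemma distr_measure_of_isomorphism:
  fixes \<mu> :: "'a::topological_space set \<Rightarrow> ennreal" and T :: "'a \<Rightarrow> 'b::topological_space"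
  assumes T: "T \<in> borel \<rightarrow>\<^sub>M borel" and T': "T' \<in> borel \<rightarrow>\<^sub>M borel"
    and inv: "\<And>x. T' (T x) = x" "\<And>y. T (T' y) = y"
  shows "distr (measure_of UNIV (sets borel) \<mu>) borel T
    = measure_of UNIV (sets borel) (\<lambda>A. \<mu> (T -` A))"
proof (rule measure_eqI)
  have vimage_inv: "T' -` (T -` A) = A" "T -` (T' -` B) = B" for A B
    by (auto simp: inv)
  \<comment> \<open>Pulling back along \<open>T\<close> gives one direction; pulling back further
    along \<open>T'\<close> undoes it and gives the other.\<close>
  have iff: "measure_space UNIV (sets borel) (\<lambda>A. \<mu> (T -` A))
      \<longleftrightarrow> measure_space UNIV (sets borel) \<mu>"
    using measure_space_vimage[OF T, of \<mu>] measure_space_vimage[OF T', of "\<lambda>A. \<mu> (T -` A)"]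
    by (auto simp: vimage_inv)
  show "sets (distr (measure_of UNIV (sets borel) \<mu>) borel T)
      = sets (measure_of UNIV (sets borel) (\<lambda>A. \<mu> (T -` A)))"
    by (simp add: sets_measure_of_conv)
  fix A assume "A \<in> sets (distr (measure_of UNIV (sets borel) \<mu>) borel T)"
  then have A: "A \<in> sets borel" by simp
  have TA: "T -` A \<in> sets borel" using measurable_sets[OF T A] by simp
  have m: "T \<in> measure_of UNIV (sets borel) \<mu> \<rightarrow>\<^sub>M borel"
    using T by (subst measurable_cong_sets[OF _ refl, of _ borel]) simp_all
  show "emeasure (distr (measure_of UNIV (sets borel) \<mu>) borel T) A
      = emeasure (measure_of UNIV (sets borel) (\<lambda>A. \<mu> (T -` A))) A"
    using A TA by (simp add: emeasure_distr[OF m] emeasure_measure_of_conv iff)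
qed

section \<open>The space of configurations\<close>

text \<open>The space of a supremum is the union of the spaces, which would be empty for an empty
  family.\<close>

lemma bounded_borel_sets_nonempty: "{A \<in> sets (borel :: 'a::metric_space measure). bounded A} \<noteq> {}"
  using bounded_empty by blast

lemma space_configuration_space: "space configuration_space = configurations"
  unfolding configuration_space_def using bounded_borel_sets_nonempty
  by (subst space_Sup_eq_UN) auto

lemma sets_configuration: "\<phi> \<in> configurations \<Longrightarrow> sets \<phi> = sets borel"
  by (simp add: configurations_def)

lemma measurable_emeasure_configuration_space:
  assumes "A \<in> sets borel" "bounded A"
  shows "(\<lambda>\<phi>. emeasure \<phi> A) \<in> borel_measurable configuration_space"
  unfolding configuration_space_def
proof (rule measurable_Sup1)
  show "vimage_algebra configurations (\<lambda>\<phi>. emeasure \<phi> A) borel \<in>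
      (\<lambda>A. vimage_algebra configurations (\<lambda>\<phi>. emeasure \<phi> A) borel) ` {A \<in> sets borel. bounded A}"
    using assms by blast
  show "(\<lambda>\<phi>. emeasure \<phi> A) \<in>
      borel_measurable (vimage_algebra configurations (\<lambda>\<phi>. emeasure \<phi> A) borel)"
    by (rule measurable_vimage_algebra1) simp
qed auto

text \<open>The universal property of the initial sigma-algebra: counts in bounded Borel sets decide
  measurability.\<close>

lemma measurable_configuration_spaceI:
  assumes "\<And>x. x \<in> space M \<Longrightarrow> f x \<in> configurations"
    and "\<And>A. A \<in> sets borel \<Longrightarrow> bounded A \<Longrightarrow> (\<lambda>x. emeasure (f x) A) \<in> borel_measurable M"
  shows "f \<in> M \<rightarrow>\<^sub>M configuration_space"
  unfolding configuration_space_def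
  using assms bounded_borel_sets_nonempty
  by (intro measurable_Sup2) (auto simp: image_iff intro!: measurable_vimage_algebra2)

section \<open>Scaling of configurations\<close>

lemma sets_scale_configuration [simp]: "sets (scale_configuration a \<phi>) = sets borel"
  by (simp add: scale_configuration_def)

lemma measurable_scaleR_sets_borel:
  fixes \<phi> :: "'a::euclidean_space measure"
  assumes "sets \<phi> = sets borel"
  shows "(\<lambda>x. a *\<^sub>R x :: 'a) \<in> \<phi> \<rightarrow>\<^sub>M borel"
  by (subst measurable_cong_sets[OF assms refl]) simp

lemma emeasure_scale_configuration:
  fixes \<phi> :: "'a::euclidean_space measure"
  assumes \<phi>: "sets \<phi> = sets borel" and A: "A \<in> sets borel"
  shows "emeasure (scale_configuration a \<phi>) A = emeasure \<phi> ((\<lambda>x. a *\<^sub>R x) -` A)"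
  using emeasure_distr[OF measurable_scaleR_sets_borel[OF \<phi>] A] sets_eq_imp_space_eq[OF \<phi>]
  by (simp add: scale_configuration_def)

lemma vimage_scaleR_borel:
  "A \<in> sets borel \<Longrightarrow> (\<lambda>x::'a::euclidean_space. a *\<^sub>R x) -` A \<in> sets borel"
  using measurable_sets[of "\<lambda>x::'a. a *\<^sub>R x" borel borel A] by simp

text \<open>The preimage lies in the image of \<open>A\<close> under scaling by
  \<open>inverse a\<close>. Local finiteness and the generators of the sigma-algebra concern bounded
  sets only, so scaling has to preserve boundedness.\<close>

lemma bounded_vimage_scaleR:
  fixes A :: "'a::euclidean_space set"
  assumes "a \<noteq> 0" "bounded A"
  shows "bounded ((\<lambda>x. a *\<^sub>R x) -` A)"
proof -
  have "(\<lambda>x. a *\<^sub>R x) -` A \<subseteq> (\<lambda>x. inverse a *\<^sub>R x) ` A"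
    using assms(1) by (auto intro!: image_eqI[where x = "a *\<^sub>R _"])
  then show ?thesis
    using bounded_scaling[OF assms(2), of "inverse a"] bounded_subset by blast
qed

lemma scale_configuration_in_configurations:
  fixes \<phi> :: "'a::euclidean_space measure"
  assumes a: "a \<noteq> 0" and \<phi>: "\<phi> \<in> configurations"
  shows "scale_configuration a \<phi> \<in> configurations"
  unfolding configurations_def
proof (intro CollectI conjI ballI impI)
  have sets: "sets \<phi> = sets borel"
    and nat: "\<And>A. A \<in> sets borel \<Longrightarrow> emeasure \<phi> A \<in> \<nat> \<union> {\<infinity>}"
    and fin: "\<And>A. A \<in> sets borel \<Longrightarrow> bounded A \<Longrightarrow> emeasure \<phi> A < \<infinity>"
    using \<phi> by (auto simp: configurations_def)
  fix A :: "'a set"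
  assume A: "A \<in> sets borel"
  show "emeasure (scale_configuration a \<phi>) A \<in> \<nat> \<union> {\<infinity>}"
    unfolding emeasure_scale_configuration[OF sets A] by (rule nat[OF vimage_scaleR_borel[OF A]])
  assume "bounded A"
  then show "emeasure (scale_configuration a \<phi>) A < \<infinity>"
    unfolding emeasure_scale_configuration[OF sets A]
    by (intro fin vimage_scaleR_borel[OF A] bounded_vimage_scaleR[OF a])
qed simp

text \<open>Evaluation at \<open>A\<close> after scaling is evaluation at the preimage of
  \<open>A\<close>, again a bounded Borel set.\<close>

lemma measurable_scale_configuration:
  assumes a: "a \<noteq> 0"
  shows "scale_configuration a \<in> configuration_space \<rightarrow>\<^sub>M configuration_space"
proof (rule measurable_configuration_spaceI)
  fix A :: "'a set"
  assume A: "A \<in> sets borel" "bounded A"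
  have "(\<lambda>\<phi>. emeasure \<phi> ((\<lambda>x::'a. a *\<^sub>R x) -` A)) \<in> borel_measurable configuration_space"
    using A by (intro measurable_emeasure_configuration_space vimage_scaleR_borel
        bounded_vimage_scaleR[OF a])
  then show "(\<lambda>\<phi>::'a measure. emeasure (scale_configuration a \<phi>) A)
      \<in> borel_measurable configuration_space"
    by (rule measurable_cong[THEN iffD1, rotated])
      (simp add: emeasure_scale_configuration sets_configuration space_configuration_space A)
qed (simp add: space_configuration_space scale_configuration_in_configurations[OF a])

lemma scale_configuration_inverse:
  fixes \<phi> :: "'a::euclidean_space measure"
  assumes "a * b = 1" and \<phi>: "sets \<phi> = sets borel"
  shows "scale_configuration a (scale_configuration b \<phi>) = \<phi>"
proof -
  have "scale_configuration a (scale_configuration b \<phi>) = distr \<phi> borel (\<lambda>x. x)"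
    using assms unfolding scale_configuration_def
    by (subst distr_distr) (simp_all add: measurable_scaleR_sets_borel o_def)
  also have "\<dots> = \<phi>"
    by (rule distr_id2[OF \<phi>[symmetric]])
  finally show ?thesis .
qed

text \<open>Scaling carries the Dirac measure at \<open>x\<close> to the one at
  \<open>a *\<^sub>R x\<close>. If \<open>x\<close> is not a point of \<open>\<phi>\<close>, the
  truncated difference may fail to be additive; \<open>distr_measure_of_isomorphism\<close> covers
  this case too, so the integrand can be rewritten at every \<open>x\<close>.\<close>

lemma remove_point_scale_configuration:
  fixes \<phi> :: "'a::euclidean_space measure"
  assumes a: "a \<noteq> 0" and \<phi>: "sets \<phi> = sets borel"
  shows "remove_point (scale_configuration a \<phi>) (a *\<^sub>R x)
    = scale_configuration a (remove_point \<phi> x)"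
proof -
  let ?T = "\<lambda>x::'a. a *\<^sub>R x"
  have sp: "space \<phi> = UNIV" using sets_eq_imp_space_eq[OF \<phi>] by simp
  have "scale_configuration a (remove_point \<phi> x) = measure_of UNIV (sets borel)
      (\<lambda>A. emeasure \<phi> (?T -` A) - emeasure (return borel x) (?T -` A))"
    unfolding scale_configuration_def remove_point_def diff_measure_def \<phi> sp
    by (rule distr_measure_of_isomorphism[where T' = "\<lambda>x. inverse a *\<^sub>R x"])
      (use a in simp_all)
  also have "\<dots> = measure_of UNIV (sets borel)
      (\<lambda>A. emeasure (scale_configuration a \<phi>) A - emeasure (return borel (a *\<^sub>R x)) A)"
    by (rule measure_of_eq)
      (simp_all add: emeasure_scale_configuration[OF \<phi>] vimage_scaleR_borel indicator_def)
  also have "\<dots> = remove_point (scale_configuration a \<phi>) (a *\<^sub>R x)"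
    by (simp add: remove_point_def diff_measure_def scale_configuration_def)
  finally show ?thesis ..
qed

lemma nn_integral_scale_configuration:
  fixes \<phi> :: "'a::euclidean_space measure"
  assumes "a \<noteq> 0" and \<phi>: "sets \<phi> = sets borel"
  shows "(\<integral>\<^sup>+x. f x \<partial>scale_configuration a \<phi>) = (\<integral>\<^sup>+x. f (a *\<^sub>R x) \<partial>\<phi>)"
  unfolding scale_configuration_def
proof (rule nn_integral_distr_isomorphism[where T' = "\<lambda>x. inverse a *\<^sub>R x"])
  show "(\<lambda>x. inverse a *\<^sub>R x) \<in> borel \<rightarrow>\<^sub>M \<phi>"
    by (subst measurable_cong_sets[OF refl \<phi>]) simp
qed (use assms in \<open>simp_all add: measurable_scaleR_sets_borel\<close>)

text \<open>Substitution of \<open>b *\<^sub>R y\<close> for \<open>x\<close>: Lebesgue measure is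
  its own image under this dilation, weighted by the Jacobian \<open>b ^ DIM('a)\<close>.\<close>

lemma nn_integral_lborel_scaleR:
  fixes f :: "'a::euclidean_space \<Rightarrow> ennreal"
  assumes f: "f \<in> borel_measurable borel" and b: "b > 0"
  shows "(\<integral>\<^sup>+x. f x \<partial>lborel) = (\<integral>\<^sup>+y. ennreal (b ^ DIM('a)) * f (b *\<^sub>R y) \<partial>lborel)"
proof -
  have "(\<integral>\<^sup>+x. f x \<partial>lborel)
      = (\<integral>\<^sup>+x. f x \<partial>density (distr lborel borel (\<lambda>x. 0 + b *\<^sub>R x)) (\<lambda>_. \<bar>b\<bar> ^ DIM('a)))"
    using lborel_affine[of b "0::'a"] b by simp
  also have "\<dots> = (\<integral>\<^sup>+y. ennreal (b ^ DIM('a)) * f (b *\<^sub>R y) \<partial>lborel)"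
    using f b by (simp add: nn_integral_density nn_integral_distr)
  finally show ?thesis .
qed

section \<open>Rescaling of the Papangelou intensity\<close>

text \<open>Abstract reciprocal factors \<open>a\<close> and \<open>b\<close> keep roots of
  \<open>\<epsilon>\<close> out of the argument. The candidate is a function on all configurations
  because the integral identity evaluates it along the whole, possibly infinite, process.\<close>

lemma papangelou_intensity_scale_configuration:
  fixes \<Phi> :: "'w \<Rightarrow> 'a::euclidean_space measure"
  assumes P: "papangelou_intensity M \<Phi> c" and a: "a > 0" and ab: "a * b = 1"
  shows "papangelou_intensity M (\<lambda>\<omega>. scale_configuration a (\<Phi> \<omega>))
    (\<lambda>x \<phi>. b ^ DIM('a) * c (b *\<^sub>R x) (scale_configuration b \<phi>))"
  unfolding papangelou_intensity_def
proof (intro conjI allI ballI impI)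
  have b: "b > 0" using a ab by (metis zero_less_mult_pos zero_less_one)
  have "prob_space M" and \<Phi> [measurable]: "\<Phi> \<in> M \<rightarrow>\<^sub>M configuration_space"
    and c [measurable]: "case_prod c \<in> borel_measurable (borel \<Otimes>\<^sub>M configuration_space)"
    and c_nonneg: "\<And>x \<phi>. \<phi> \<in> configurations \<Longrightarrow> 0 \<le> c x \<phi>"
    and GNZ: "\<And>u. u \<in> borel_measurable (borel \<Otimes>\<^sub>M configuration_space) \<Longrightarrow>
        (\<integral>\<^sup>+\<omega>. (\<integral>\<^sup>+x. u (x, remove_point (\<Phi> \<omega>) x) \<partial>\<Phi> \<omega>) \<partial>M)
          = (\<integral>\<^sup>+x. (\<integral>\<^sup>+\<omega>. ennreal (c x (\<Phi> \<omega>)) * u (x, \<Phi> \<omega>) \<partial>M) \<partial>lborel)"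
    using P by (auto simp: papangelou_intensity_def point_process_def)
  \<comment> \<open>Sigma-finiteness of \<open>M\<close> makes the inner integral over
    \<open>\<omega>\<close> measurable in \<open>x\<close>, as the substitution requires.\<close>
  interpret prob_space M by fact
  have [measurable]: "scale_configuration a \<in> configuration_space \<rightarrow>\<^sub>M
        (configuration_space :: 'a measure measure)"
    "scale_configuration b \<in> configuration_space \<rightarrow>\<^sub>M
        (configuration_space :: 'a measure measure)"
    using a b by (auto intro!: measurable_scale_configuration)
  have conf: "\<Phi> \<omega> \<in> configurations" if "\<omega> \<in> space M" for \<omega>
    using measurable_space[OF \<Phi> that] by (simp add: space_configuration_space)
  show "point_process M (\<lambda>\<omega>. scale_configuration a (\<Phi> \<omega>))"
    using \<open>prob_space M\<close> by (simp add: point_process_def)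
  show "(\<lambda>(x, \<phi>). b ^ DIM('a) * c (b *\<^sub>R x) (scale_configuration b \<phi>))
      \<in> borel_measurable (borel \<Otimes>\<^sub>M configuration_space)"
    by measurable
  show "0 \<le> b ^ DIM('a) * c (b *\<^sub>R x) (scale_configuration b \<phi>)"
    if "\<phi> \<in> configurations" for x \<phi>
    using b scale_configuration_in_configurations[OF _ that, of b] by (simp add: c_nonneg)
  fix u :: "'a \<times> 'a measure \<Rightarrow> ennreal"
  assume u [measurable]: "u \<in> borel_measurable (borel \<Otimes>\<^sub>M configuration_space)"
  \<comment> \<open>The test function for \<open>\<Phi>\<close> that corresponds to
    \<open>u\<close>: point and configuration are scaled together.\<close>
  define v where "v = (\<lambda>(x, \<phi>). u (a *\<^sub>R x, scale_configuration a \<phi>))"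
  have v [measurable]: "v \<in> borel_measurable (borel \<Otimes>\<^sub>M configuration_space)"
    unfolding v_def by measurable
  have "(\<integral>\<^sup>+\<omega>. (\<integral>\<^sup>+x. u (x, remove_point (scale_configuration a (\<Phi> \<omega>)) x)
        \<partial>scale_configuration a (\<Phi> \<omega>)) \<partial>M)
      = (\<integral>\<^sup>+\<omega>. (\<integral>\<^sup>+x. v (x, remove_point (\<Phi> \<omega>) x) \<partial>\<Phi> \<omega>) \<partial>M)"
    using a by (intro nn_integral_cong) (simp add: nn_integral_scale_configuration
        remove_point_scale_configuration sets_configuration[OF conf] v_def)
  also have "\<dots> = (\<integral>\<^sup>+x. (\<integral>\<^sup>+\<omega>. ennreal (c x (\<Phi> \<omega>)) * v (x, \<Phi> \<omega>) \<partial>M) \<partial>lborel)"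
    by (rule GNZ[OF v])
  also have "\<dots> = (\<integral>\<^sup>+y. ennreal (b ^ DIM('a)) *
      (\<integral>\<^sup>+\<omega>. ennreal (c (b *\<^sub>R y) (\<Phi> \<omega>)) * v (b *\<^sub>R y, \<Phi> \<omega>) \<partial>M) \<partial>lborel)"
    by (rule nn_integral_lborel_scaleR[OF _ b]) measurable
  also have "\<dots> = (\<integral>\<^sup>+y. (\<integral>\<^sup>+\<omega>. ennreal (b ^ DIM('a)) *
      (ennreal (c (b *\<^sub>R y) (\<Phi> \<omega>)) * v (b *\<^sub>R y, \<Phi> \<omega>)) \<partial>M) \<partial>lborel)"
    by (intro nn_integral_cong nn_integral_cmult[symmetric]) measurable
  \<comment> \<open>Since \<open>a * b = 1\<close>, \<open>v\<close> at \<open>b *\<^sub>R y\<close>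
    becomes \<open>u\<close> at \<open>y\<close> and the scaled process, while scaling that process
    by \<open>b\<close> returns \<open>\<Phi> \<omega>\<close>, the argument of
    \<open>c\<close>.\<close>
  also have "\<dots> = (\<integral>\<^sup>+y. (\<integral>\<^sup>+\<omega>.
      ennreal (b ^ DIM('a) * c (b *\<^sub>R y) (scale_configuration b (scale_configuration a (\<Phi> \<omega>))))
      * u (y, scale_configuration a (\<Phi> \<omega>)) \<partial>M) \<partial>lborel)"
    using ab b by (intro nn_integral_cong)
      (simp add: scale_configuration_inverse sets_configuration[OF conf] v_def
        ennreal_mult c_nonneg[OF conf] mult.assoc mult.commute[of b a])
  finally show "(\<integral>\<^sup>+\<omega>. (\<integral>\<^sup>+x. u (x, remove_point (scale_configuration a (\<Phi> \<omega>)) x)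
        \<partial>scale_configuration a (\<Phi> \<omega>)) \<partial>M)
      = (\<integral>\<^sup>+y. (\<integral>\<^sup>+\<omega>.
      ennreal (b ^ DIM('a) * c (b *\<^sub>R y) (scale_configuration b (scale_configuration a (\<Phi> \<omega>))))
      * u (y, scale_configuration a (\<Phi> \<omega>)) \<partial>M) \<partial>lborel)" .
qed

theorem theorem4p8:
  fixes M :: "'w measure"
    and \<Phi> :: "'w \<Rightarrow> 'a::euclidean_space measure"
    and c :: "'a \<Rightarrow> 'a measure \<Rightarrow> real"
    and \<epsilon> :: real
  assumes "point_process M \<Phi>"
    and "papangelou_intensity M \<Phi> c"
    and "\<epsilon> > 0"
  shows "\<exists>c\<^sub>\<epsilon>. papangelou_intensity M (rescaling \<epsilon> \<Phi>) c\<^sub>\<epsilon> \<and>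
           (\<forall>x. \<forall>\<phi>\<in>finite_configurations.
              c\<^sub>\<epsilon> x \<phi> =
                1 / \<epsilon> * c (\<epsilon> powr (- 1 / real DIM('a)) *\<^sub>R x)
                          (scale_configuration (\<epsilon> powr (- 1 / real DIM('a))) \<phi>))"
proof -
  \<comment> \<open>\<open>a\<close> is the factor in \<open>rescaling\<close> and \<open>b\<close>
    its reciprocal, as the exponents cancel.\<close>
  define a b where "a = \<epsilon> powr (1 / real DIM('a))" and "b = \<epsilon> powr (- 1 / real DIM('a))"
  have "a > 0" and "a * b = 1"
    using \<open>\<epsilon> > 0\<close> by (simp_all add: a_def b_def flip: powr_add)
  then have "papangelou_intensity M (rescaling \<epsilon> \<Phi>)
      (\<lambda>x \<phi>. b ^ DIM('a) * c (b *\<^sub>R x) (scale_configuration b \<phi>))"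
    unfolding rescaling_def a_def[symmetric]
    by (intro papangelou_intensity_scale_configuration[OF assms(2)])
  moreover have "b ^ DIM('a) = 1 / \<epsilon>"
  proof -
    \<comment> \<open>Written as a real power, the exponents multiply to \<open>-1\<close> because
      the dimension is positive.\<close>
    have "b ^ DIM('a) = \<epsilon> powr (- 1 / real DIM('a) * real DIM('a))"
      unfolding b_def using \<open>\<epsilon> > 0\<close> by (subst powr_realpow[symmetric]) (simp_all only: powr_powr powr_gt_zero)
    also have "\<dots> = 1 / \<epsilon>"
      using \<open>\<epsilon> > 0\<close> by (simp add: powr_minus_divide)
    finally show ?thesis .
  qed
  ultimately show ?thesis
    unfolding b_def by auto
qed

end
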